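(* Let $p\ge 1$ and $k\in\mathbb{N}^p$ with $k\neq 0$. The differential cumulant equals the limit of the normalized local cumulant, i.e. $$\kappa_k^\xi=\lim_{\epsilon\to 0^+}\frac{1}{r(\epsilon,k)}\,\kappa_k^A$$ (as an identity valid for every random vector $X$ in $\mathbb{R}^p$ with strictly positive, $p+1$ times continuously differentiable density $f_X$ and every point $\xi\in\mathbb{R}^p$), if and only if $k$ is binary, i.e. $k\in\{0,1\}^p$.
   Context: Here $\mathbb{N}$ includes $0$, and $0$ counts as even. For $v\in\mathbb{N}^p$, $v!=\prod_i v_i!$ and $\|v\|_1=\sum_i v_i$. Local moments. For $\xi\in\mathbb{R}^p$ and $\epsilon>0$ let $A=\prod_{i=1}^p[\xi_i-\epsilon,\xi_i+\epsilon]$. For $k\in\mathbb{N}^p$ the local moment is $m_k^A=\mathbb{E}\big(\prod_{i=1}^p(X_i-\xi_i)^{k_i}\mid X\in A\big)$. Normalization. Let $\|k\|_1^+=\|k\|_1+\#\{i: k_i\text{ odd}\}$ and $$r(\epsilon,k)=\epsilon^{\|k\|_1^+}\prod_{i:\,k_i\text{ even}}\frac{1}{k_i+1}\prod_{i:\,k_i\text{ odd}}\frac{1}{k_i+2}.$$ Differential moments: $m_k^\xi=\lim_{\epsilon\to0^+}m_k^A/r(\epsilon,k)$ (for $k=0$ this is $1$). Multisets and partitions. To $k\in\mathbb{N}^p$ associate the multiset $M$ on $\{1,\dots,p\}$ containing $i$ with multiplicity $k_i$; the multiplicity vector of a multiset $M$ is denoted $\nu_M$. A partition $\pi$ of $M$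 is a multiset $\{M_1,\dots,M_{|\pi|}\}$ of nonempty multisets with $\sum_j\nu_{M_j}=\nu_M$; $|\pi|$ is the number of blocks counted with multiplicity. $\Pi(k)$ is the set of all partitions of the multiset with multiplicity vector $k$. The collapse number is $$c(\pi)=\frac{\nu_M!}{\big(\prod_{j=1}^{|\pi|}\nu_{M_j}!\big)\,\nu_\pi!},$$ where $\nu_\pi!$ is the product of the factorials of the multiplicities with which the distinct blocks occur in $\pi$. Local cumulants and differential cumulants are obtained from the local moments, respectively the differential moments, by the usual moment-to-cumulant formula: $$\kappa_k^A=\sum_{\pi\in\Pi(k)}c(\pi)(-1)^{|\pi|-1}(|\pi|-1)!\prod_{j=1}^{|\pi|}m^A_{\nu_{M_j}},\qquad \kappa_k^\xi=\sum_{\pi\in\Pi(k)}c(\pi)(-1)^{|\pi|-1}(|\pi|-1)!\prod_{j=1}^{|\pi|}m^\xi_{\nu_{M_j}}.$$ *)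

theory Defs
  imports "HOL-Probability.Probability" "HOL-Library.Multiset"
begin

(* Successive Frechet derivatives, evaluated at arbitrary directions; on a finite-dimensional
   space Ck n is the usual "n times continuously differentiable". *)
primrec Ck :: "nat \<Rightarrow> ('a::real_normed_vector \<Rightarrow> real) \<Rightarrow> bool" where
  "Ck 0 f \<longleftrightarrow> continuous_on UNIV f"
| "Ck (Suc n) f \<longleftrightarrow>
     (\<forall>x. f differentiable (at x)) \<and> (\<forall>v. Ck n (\<lambda>x. frechet_derivative f (at x) v))"

definition cube :: "real ^ 'n \<Rightarrow> real \<Rightarrow> (real ^ 'n) set" where
  "cube \<xi> \<epsilon> = cbox (\<chi> i. \<xi> $ i - \<epsilon>) (\<chi> i. \<xi> $ i + \<epsilon>)"

(* The conditional expectation given the event B is E(Y; B) / P(B). *)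
definition local_moment ::
  "'a measure \<Rightarrow> ('a \<Rightarrow> real ^ 'n::finite) \<Rightarrow> real ^ 'n \<Rightarrow> real \<Rightarrow> ('n \<Rightarrow> nat) \<Rightarrow> real" where
  "local_moment M X \<xi> \<epsilon> k =
     (let B = {\<omega> \<in> space M. X \<omega> \<in> cube \<xi> \<epsilon>}
      in (LINT \<omega>:B|M. (\<Prod>i\<in>UNIV. (X \<omega> $ i - \<xi> $ i) ^ k i)) / measure M B)"

definition norm1_plus :: "('n::finite \<Rightarrow> nat) \<Rightarrow> nat" where
  "norm1_plus k = (\<Sum>i\<in>UNIV. k i) + card {i. odd (k i)}"

definition normalization :: "real \<Rightarrow> ('n::finite \<Rightarrow> nat) \<Rightarrow> real" where
  "normalization \<epsilon> k =
     \<epsilon> ^ norm1_plus k * (\<Prod>i | even (k i). 1 / (real (k i) + 1))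
                     * (\<Prod>i | odd (k i). 1 / (real (k i) + 2))"

(* Lim is only specified when the limit exists; for a positive Ck (CARD('n) + 1) density it does. *)
definition differential_moment ::
  "'a measure \<Rightarrow> ('a \<Rightarrow> real ^ 'n::finite) \<Rightarrow> real ^ 'n \<Rightarrow> ('n \<Rightarrow> nat) \<Rightarrow> real" where
  "differential_moment M X \<xi> k =
     Lim (at_right 0) (\<lambda>\<epsilon>. local_moment M X \<xi> \<epsilon> k / normalization \<epsilon> k)"

(* The multiplicity vector of a multiset is its count function. *)
definition multiset_partitions :: "('n \<Rightarrow> nat) \<Rightarrow> 'n multiset multiset set" where
  "multiset_partitions k = {\<pi>. {#} \<notin># \<pi> \<and> count (\<Sum>\<^sub># \<pi>) = k}"

definition vfact :: "('n::finite \<Rightarrow> nat) \<Rightarrow> real" where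
  "vfact v = (\<Prod>i\<in>UNIV. fact (v i))"

definition collapse_number :: "'n::finite multiset multiset \<Rightarrow> real" where
  "collapse_number \<pi> =
     vfact (count (\<Sum>\<^sub># \<pi>)) /
       ((\<Prod>B\<in>#\<pi>. vfact (count B)) * (\<Prod>B\<in>set_mset \<pi>. fact (count \<pi> B)))"

definition cumulant_of_moments :: "(('n::finite \<Rightarrow> nat) \<Rightarrow> real) \<Rightarrow> ('n \<Rightarrow> nat) \<Rightarrow> real" where
  "cumulant_of_moments m k =
     (\<Sum>\<pi>\<in>multiset_partitions k.
        collapse_number \<pi> * (-1) ^ (size \<pi> - 1) * fact (size \<pi> - 1) * (\<Prod>B\<in>#\<pi>. m (count B)))"

(* The sum defining cumulant_of_moments is a genuine finite sum. *)
lemma finite_multiset_partitions: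
  fixes k :: "'n::finite \<Rightarrow> nat"
  shows "finite (multiset_partitions k)"
proof -
  define n where "n = (\<Sum>i\<in>UNIV. k i)"
  have lists: "finite (mset ` {xs. set xs \<subseteq> S \<and> length xs \<le> n})" if "finite S" for S :: "'b set"
    using finite_lists_length_le[OF that, of n] by (rule finite_imageI)
  have size_le: "size \<pi> \<le> size (\<Sum>\<^sub># \<pi>)" if "{#} \<notin># \<pi>" for \<pi> :: "'n multiset multiset"
    using that by (induction \<pi>) (auto simp: Suc_le_eq nonempty_has_size intro: add_less_le_mono
        dest: order_trans)
  have mem: "N \<in> mset ` {xs. set xs \<subseteq> S \<and> length xs \<le> n}"
    if "set_mset N \<subseteq> S" "size N \<le> n" for N :: "'b multiset" and S
    using that by (metis (mono_tags, lifting) ex_mset image_eqI mem_Collect_eq set_mset_mset size_mset)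
  let ?A = "mset ` {xs. set xs \<subseteq> (UNIV :: 'n set) \<and> length xs \<le> n}"
  have "multiset_partitions k \<subseteq> mset ` {xs. set xs \<subseteq> ?A \<and> length xs \<le> n}"
  proof
    fix \<pi> assume "\<pi> \<in> multiset_partitions k"
    then have ne: "{#} \<notin># \<pi>" and k: "count (\<Sum>\<^sub># \<pi>) = k"
      by (auto simp: multiset_partitions_def)
    have "size (\<Sum>\<^sub># \<pi>) = (\<Sum>i\<in>UNIV. count (\<Sum>\<^sub># \<pi>) i)"
      unfolding size_multiset_overloaded_eq
      by (rule sum.mono_neutral_left) (simp_all del: set_mset_Union_mset add: count_eq_zero_iff)
    then have n: "size (\<Sum>\<^sub># \<pi>) = n"
      by (simp add: n_def k)
    have "size B \<le> n" if "B \<in># \<pi>" for B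
      using that n by (metis size_mset_mono sum_mset.remove mset_subset_eq_add_left)
    then have "set_mset \<pi> \<subseteq> ?A"
      by (intro subsetI mem) auto
    moreover have "size \<pi> \<le> n"
      using size_le[OF ne] n by simp
    ultimately show "\<pi> \<in> mset ` {xs. set xs \<subseteq> ?A \<and> length xs \<le> n}"
      by (rule mem)
  qed
  then show ?thesis
    using lists[OF lists[OF finite_class.finite_UNIV]] by (rule finite_subset)
qed

definition local_cumulant ::
  "'a measure \<Rightarrow> ('a \<Rightarrow> real ^ 'n::finite) \<Rightarrow> real ^ 'n \<Rightarrow> real \<Rightarrow> ('n \<Rightarrow> nat) \<Rightarrow> real" where
  "local_cumulant M X \<xi> \<epsilon> k = cumulant_of_moments (local_moment M X \<xi> \<epsilon>) k"

definition differential_cumulant ::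
  "'a measure \<Rightarrow> ('a \<Rightarrow> real ^ 'n::finite) \<Rightarrow> real ^ 'n \<Rightarrow> ('n \<Rightarrow> nat) \<Rightarrow> real" where
  "differential_cumulant M X \<xi> k = cumulant_of_moments (differential_moment M X \<xi>) k"

(* The first argument names the type of sample points, which cannot be quantified inside a formula.
   Every law on real ^ 'n occurs already for the sample type real ^ 'n, with X the identity. *)
definition cumulant_limit_identity :: "'a itself \<Rightarrow> ('n::finite \<Rightarrow> nat) \<Rightarrow> bool" where
  "cumulant_limit_identity _ k \<longleftrightarrow>
     (\<forall>(M :: 'a measure) (X :: 'a \<Rightarrow> real ^ 'n) f \<xi>.
        prob_space M \<longrightarrow> distributed M lborel X (\<lambda>x. ennreal (f x)) \<longrightarrow>
        (\<forall>x. 0 < f x) \<longrightarrow> Ck (CARD('n) + 1) f \<longrightarrow>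
        ((\<lambda>\<epsilon>. 1 / normalization \<epsilon> k * local_cumulant M X \<xi> \<epsilon> k)
           \<longlongrightarrow> differential_cumulant M X \<xi> k) (at_right 0))"

end

theory Submission
  imports Defs "HOL-Computational_Algebra.Polynomial"
begin

text \<open>
  Reflecting the cube in the coordinates with odd exponent replaces the density by its iterated odd
  part, which by the mean value theorem is the product of these coordinates times a mixed partial
  derivative at a nearby point. Hence \<open>m\<^sub>k / r(\<epsilon>, k)\<close> tends to \<open>\<partial>\<^sub>O f(\<xi>) / f(\<xi>)\<close>, where \<open>O\<close> is the
  set of odd coordinates of \<open>k\<close>. After normalizing every moment, the term of a partition \<open>\<pi>\<close> in the
  normalized local cumulant carries the additional factor \<open>(\<Prod>\<^sub>j r(\<epsilon>, M\<^sub>j)) / r(\<epsilon>, k)\<close>. For binary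
  \<open>k\<close> this factor is 1, whereas if some \<open>k\<^sub>i \<ge> 2\<close>, it tends to 0 for the partition into singletons. For
  the Gaussian density tilted by \<open>1 + t (\<Sum>\<^sub>i sin x\<^sub>i)\<close> the differential moments at 0 are 1, \<open>t\<close> or 0
  according to whether \<open>O\<close> is empty, a singleton or larger. Both sides are then polynomials in \<open>t\<close>, and
  only the partition into singletons can contribute to the coefficient of \<open>t\<^sup>n\<close>, where \<open>n\<close> is the sum
  of the \<open>k\<^sub>i\<close>: it does so in the differential cumulant but not in the limit.
\<close>

section \<open>Reflections and odd parts\<close>

text \<open>The reflection in the hyperplane through \<open>\<xi>\<close> orthogonal to axis
  \<open>i\<close>, written as a displacement along that axis so that its derivative can be read
  off.\<close>

definition reflect :: "real ^ 'n \<Rightarrow> 'n \<Rightarrow> real ^ 'n \<Rightarrow> real ^ 'n" where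
  "reflect \<xi> i x = x + (2 * (\<xi> $ i - x $ i)) *\<^sub>R axis i 1"

definition odd_part :: "real ^ 'n \<Rightarrow> 'n \<Rightarrow> (real ^ 'n \<Rightarrow> real) \<Rightarrow> real ^ 'n \<Rightarrow> real" where
  "odd_part \<xi> i f x = (f x - f (reflect \<xi> i x)) / 2"

abbreviation partial :: "'n \<Rightarrow> (real ^ 'n \<Rightarrow> real) \<Rightarrow> real ^ 'n \<Rightarrow> real" where
  "partial i f x \<equiv> frechet_derivative f (at x) (axis i 1)"

text \<open>The head of the list is differentiated first; this is the order in which
  \<open>odd_parts_mvt\<close> produces the derivatives.\<close>

primrec mixed_partial :: "'n list \<Rightarrow> (real ^ 'n \<Rightarrow> real) \<Rightarrow> real ^ 'n \<Rightarrow> real" where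
  "mixed_partial [] f = f"
| "mixed_partial (i # is) f = mixed_partial is (partial i f)"

lemma reflect_nth: "reflect \<xi> i x $ j = (if j = i then 2 * \<xi> $ i - x $ i else x $ j)"
  by (simp add: reflect_def axis_def)

lemma reflect_has_derivative:
  "(reflect \<xi> i has_derivative (\<lambda>v. v - (2 * v $ i) *\<^sub>R axis i 1)) (at x)"
  unfolding reflect_def
  by (auto intro!: derivative_eq_intros bounded_linear.has_derivative[OF bounded_linear_vec_nth]
      simp: algebra_simps)

lemma continuous_on_reflect: "continuous_on UNIV (reflect \<xi> i)"
  unfolding reflect_def by (intro continuous_intros)

lemma measurable_reflect [measurable]: "reflect \<xi> i \<in> borel_measurable borel"
  by (rule borel_measurable_continuous_onI[OF continuous_on_reflect])

text \<open>The reflection is affine with a diagonal linear part whose entries \<open>c b\<close>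
  are 1 or -1, so the Jacobian factor is 1.\<close>

lemma lborel_distr_reflect: "distr lborel borel (reflect \<xi> i) = (lborel :: (real ^ 'n::finite) measure)"
proof -
  define c :: "real ^ 'n \<Rightarrow> real" where "c b = (if b = axis i 1 then - 1 else 1)" for b
  have basis: "(axis i 1 :: real ^ 'n) \<in> Basis" by simp
  have "reflect \<xi> i x = (2 * \<xi> $ i) *\<^sub>R axis i 1 + (\<Sum>b\<in>Basis. (c b * (x \<bullet> b)) *\<^sub>R b)" for x
  proof -
    have "(\<Sum>b\<in>Basis. (c b * (x \<bullet> b)) *\<^sub>R b)
        = (\<Sum>b\<in>Basis. (x \<bullet> b) *\<^sub>R b - (if b = axis i 1 then 2 * (x \<bullet> b) else 0) *\<^sub>R b)"
      by (rule sum.cong) (auto simp: c_def algebra_simps scaleR_2 simp flip: scaleR_scaleR)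
    also have "\<dots> = x - (\<Sum>b\<in>Basis. if b = axis i 1 then (2 * (x \<bullet> b)) *\<^sub>R b else 0)"
      by (simp add: sum_subtractf euclidean_representation if_distrib[of "\<lambda>r. r *\<^sub>R _"] cong: if_cong)
    also have "\<dots> = x - (2 * x $ i) *\<^sub>R axis i 1"
      using basis by (simp add: inner_axis)
    finally show ?thesis by (simp add: reflect_def algebra_simps)
  qed
  then have "reflect \<xi> i = (\<lambda>x. (2 * \<xi> $ i) *\<^sub>R axis i 1 + (\<Sum>b\<in>Basis. (c b * (x \<bullet> b)) *\<^sub>R b))" by auto
  moreover have "(\<Prod>b\<in>Basis. ennreal \<bar>c b\<bar>) = 1"
    by (intro prod.neutral) (simp add: c_def)
  ultimately show ?thesis
    using lborel_affine_euclidean[of c "(2 * \<xi> $ i) *\<^sub>R axis i 1"]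
    by (simp add: c_def density_1 prod_ennreal split: if_splits)
qed

lemma integral_reflect:
  fixes g :: "real ^ 'n::finite \<Rightarrow> real"
  assumes "g \<in> borel_measurable borel"
  shows "(LINT x|lborel. g (reflect \<xi> i x)) = (LINT x|lborel. g x)"
  using integral_distr[of "reflect \<xi> i" lborel borel g] assms by (simp add: lborel_distr_reflect)

section \<open>Weighted integrals over a cube and their symmetry\<close>

lemma cube_iff: "x \<in> cube \<xi> \<epsilon> \<longleftrightarrow> (\<forall>i. \<bar>x $ i - \<xi> $ i\<bar> \<le> \<epsilon>)"
  by (auto simp: cube_def mem_box_cart abs_le_iff algebra_simps)

lemma reflect_in_cube [simp]: "reflect \<xi> i x \<in> cube \<xi> \<epsilon> \<longleftrightarrow> x \<in> cube \<xi> \<epsilon>"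
proof -
  have "\<bar>reflect \<xi> i x $ j - \<xi> $ j\<bar> = \<bar>x $ j - \<xi> $ j\<bar>" for j
    by (auto simp: reflect_nth)
  then show ?thesis by (simp add: cube_iff)
qed

definition centred_power :: "real ^ 'n \<Rightarrow> ('n::finite \<Rightarrow> nat) \<Rightarrow> real ^ 'n \<Rightarrow> real" where
  "centred_power \<xi> k x = (\<Prod>i\<in>UNIV. (x $ i - \<xi> $ i) ^ k i)"

lemma centred_power_reflect:
  assumes "odd (k i)"
  shows "centred_power \<xi> k (reflect \<xi> i x) = - centred_power \<xi> k x"
proof -
  have "(\<Prod>j\<in>UNIV. (reflect \<xi> i x $ j - \<xi> $ j) ^ k j)
      = (\<Prod>j\<in>UNIV. (if j = i then - 1 else 1) * (x $ j - \<xi> $ j) ^ k j)"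
  proof (rule prod.cong)
    fix j
    have "(\<xi> $ i - x $ i) ^ k i = (- (x $ i - \<xi> $ i)) ^ k i" by simp
    also have "\<dots> = - ((x $ i - \<xi> $ i) ^ k i)"
      using assms by (rule power_minus_odd)
    finally show "(reflect \<xi> i x $ j - \<xi> $ j) ^ k j = (if j = i then - 1 else 1) * (x $ j - \<xi> $ j) ^ k j"
      by (simp add: reflect_nth)
  qed simp
  also have "\<dots> = - (\<Prod>j\<in>UNIV. (x $ j - \<xi> $ j) ^ k j)"
    by (simp add: prod.distrib)
  finally show ?thesis by (simp add: centred_power_def)
qed

lemma continuous_on_centred_power: "continuous_on UNIV (centred_power \<xi> k)"
  unfolding centred_power_def by (intro continuous_intros)

text \<open>For a density \<open>f\<close> this is the numerator of the local moment, and exponent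
  zero gives the denominator.\<close>

definition cube_integral ::
  "(real ^ 'n \<Rightarrow> real) \<Rightarrow> real ^ 'n \<Rightarrow> real \<Rightarrow> ('n::finite \<Rightarrow> nat) \<Rightarrow> real" where
  "cube_integral f \<xi> \<epsilon> k = (LINT x:cube \<xi> \<epsilon>|lborel. centred_power \<xi> k x * f x)"

lemma set_integrable_cube:
  fixes g :: "real ^ 'n::finite \<Rightarrow> real"
  assumes "continuous_on UNIV g"
  shows "set_integrable lborel (cube \<xi> \<epsilon>) g"
  unfolding cube_def using assms
  by (intro borel_integrable_compact[folded set_integrable_def] compact_cbox)
    (rule continuous_on_subset, auto)

lemma cube_sets [measurable]: "cube \<xi> \<epsilon> \<in> sets borel"
  by (simp add: cube_def)

lemma continuous_on_odd_part:
  assumes "continuous_on UNIV f"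
  shows "continuous_on UNIV (odd_part \<xi> i f)"
  unfolding odd_part_def
  using continuous_on_compose2[OF assms continuous_on_reflect] assms
  by (intro continuous_intros) auto

text \<open>The weight changes sign under the reflection while the cube and the measure are
  invariant, so the even part of \<open>f\<close> integrates to 0.\<close>

lemma cube_integral_odd_part:
  assumes f: "continuous_on UNIV f" and k: "odd (k i)"
  shows "cube_integral (odd_part \<xi> i f) \<xi> \<epsilon> k = cube_integral f \<xi> \<epsilon> k"
proof -
  have cont: "continuous_on UNIV (\<lambda>x. f (reflect \<xi> i x))"
    using continuous_on_compose2[OF f continuous_on_reflect] by auto
  define g where "g x = indicator (cube \<xi> \<epsilon>) x *\<^sub>R (centred_power \<xi> k x * f (reflect \<xi> i x))" for x
  note [measurable] = borel_measurable_continuous_onI[OF continuous_on_centred_power]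
    borel_measurable_continuous_onI[OF cont]
  \<comment> \<open>The reflection is an involution: composing with it frees \<open>f\<close> of the
    reflection and puts it on the weight, which yields the sign.\<close>
  have "g (reflect \<xi> i x) = - (indicator (cube \<xi> \<epsilon>) x *\<^sub>R (centred_power \<xi> k x * f x))" for x
  proof -
    have "reflect \<xi> i (reflect \<xi> i x) = x"
      by (simp add: vec_eq_iff reflect_nth)
    then show ?thesis
      by (simp add: g_def centred_power_reflect k indicator_def)
  qed
  moreover have "g \<in> borel_measurable borel"
    unfolding g_def by measurable
  ultimately have "(LINT x|lborel. g x) = - cube_integral f \<xi> \<epsilon> k"
    using integral_reflect[of g \<xi> i] by (simp add: cube_integral_def set_lebesgue_integral_def)
  then have *: "(LINT x:cube \<xi> \<epsilon>|lborel. centred_power \<xi> k x * f (reflect \<xi> i x)) = - cube_integral f \<xi> \<epsilon> k"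
    by (simp add: g_def set_lebesgue_integral_def)
  have "cube_integral (odd_part \<xi> i f) \<xi> \<epsilon> k =
      (LINT x:cube \<xi> \<epsilon>|lborel. (centred_power \<xi> k x * f x - centred_power \<xi> k x * f (reflect \<xi> i x)) / 2)"
    by (simp add: cube_integral_def odd_part_def algebra_simps diff_divide_distrib)
  also have "\<dots> = ((LINT x:cube \<xi> \<epsilon>|lborel. centred_power \<xi> k x * f x)
      - (LINT x:cube \<xi> \<epsilon>|lborel. centred_power \<xi> k x * f (reflect \<xi> i x))) / 2"
    unfolding set_integral_divide_zero
    by (subst set_integral_diff) (auto intro!: set_integrable_cube continuous_intros
        continuous_on_centred_power f cont)
  also have "\<dots> = cube_integral f \<xi> \<epsilon> k"
    unfolding * by (simp add: cube_integral_def)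
  finally show ?thesis .
qed

lemma cube_integral_odd_parts:
  assumes "continuous_on UNIV f" and "\<And>i. i \<in> set is \<Longrightarrow> odd (k i)"
  shows "continuous_on UNIV (foldr (odd_part \<xi>) is f)"
    and "cube_integral (foldr (odd_part \<xi>) is f) \<xi> \<epsilon> k = cube_integral f \<xi> \<epsilon> k"
  using assms(2)
  by (induction "is") (simp_all add: assms(1) continuous_on_odd_part cube_integral_odd_part)

section \<open>Derivatives of odd parts and the mean value theorem\<close>

lemma Ck_imp_continuous: "Ck n f \<Longrightarrow> continuous_on UNIV f"
  by (cases n) (auto simp: continuous_on_eq_continuous_at differentiable_imp_continuous_within)

lemma odd_part_differentiable:
  assumes "\<And>x. f differentiable (at x)"
  shows "odd_part \<xi> i f differentiable (at x)"
  unfolding odd_part_def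
  by (intro derivative_intros differentiable_compose[of f "reflect \<xi> i"] assms
      differentiableI[OF reflect_has_derivative]) auto

text \<open>The linear part of the reflection in coordinate \<open>j\<close> fixes the direction
  \<open>axis i 1\<close> when \<open>i \<noteq> j\<close>, so the chain rule introduces no
  sign.\<close>

lemma partial_odd_part:
  assumes f: "\<And>x. f differentiable (at x)" and "i \<noteq> j"
  shows "partial i (odd_part \<xi> j f) = odd_part \<xi> j (partial i f)"
proof
  fix x
  note Df = f[unfolded frechet_derivative_works]
  have "(odd_part \<xi> j f has_derivative
      (\<lambda>v. (frechet_derivative f (at x) v
          - frechet_derivative f (at (reflect \<xi> j x)) (v - (2 * v $ j) *\<^sub>R axis j 1)) / 2)) (at x)"
    unfolding odd_part_def
    by (auto intro!: derivative_eq_intros Df has_derivative_compose[OF reflect_has_derivative Df])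
  from frechet_derivative_at[OF this, symmetric] \<open>i \<noteq> j\<close>
  show "partial i (odd_part \<xi> j f) x = odd_part \<xi> j (partial i f) x"
    by (simp add: odd_part_def axis_nth axis_def)
qed

lemma
  assumes "\<And>x. f differentiable (at x)"
  shows odd_parts_differentiable: "foldr (odd_part \<xi>) is f differentiable (at x)"
    and partial_odd_parts: "i \<notin> set is \<Longrightarrow>
      partial i (foldr (odd_part \<xi>) is f) = foldr (odd_part \<xi>) is (partial i f)"
proof -
  show diff: "foldr (odd_part \<xi>) is f differentiable (at x)" for "is" x
    by (induction "is" arbitrary: x) (simp_all add: assms odd_part_differentiable)
  show "partial i (foldr (odd_part \<xi>) is f) = foldr (odd_part \<xi>) is (partial i f)" if "i \<notin> set is"
    using that by (induction "is") (simp_all add: partial_odd_part[OF diff] del: fun_upd_apply)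
qed

text \<open>The odd part is half the increment of \<open>f\<close> along the segment from the reflection of \<open>x\<close>
  to \<open>x\<close>, so the one-dimensional mean value theorem applies.\<close>

lemma odd_part_mvt:
  assumes f: "\<And>x. f differentiable (at x)"
  shows "\<exists>z. (\<forall>j. j \<noteq> i \<longrightarrow> z $ j = x $ j) \<and> \<bar>z $ i - \<xi> $ i\<bar> \<le> \<bar>x $ i - \<xi> $ i\<bar> \<and>
    odd_part \<xi> i f x = (x $ i - \<xi> $ i) * partial i f z"
proof -
  \<comment> \<open>The i-th coordinate of \<open>p s\<close> is
    \<open>\<xi> $ i + s * (x $ i - \<xi> $ i)\<close>: the endpoints -1 and 1 give the reflection
    of \<open>x\<close> and \<open>x\<close> itself, and an intermediate \<open>s\<close> moves
    closer to the hyperplane.\<close>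
  define p where "p s = x + ((s - 1) * (x $ i - \<xi> $ i)) *\<^sub>R axis i 1" for s
  note Df = f[unfolded frechet_derivative_works]
  have p: "(p has_derivative (\<lambda>s. (s * (x $ i - \<xi> $ i)) *\<^sub>R axis i 1)) (at s)" for s
    unfolding p_def by (auto intro!: derivative_eq_intros)
  have deriv: "((\<lambda>s. f (p s)) has_derivative
      (\<lambda>s'. frechet_derivative f (at (p s)) ((s' * (x $ i - \<xi> $ i)) *\<^sub>R axis i 1))) (at s)" for s
    using has_derivative_compose[OF p Df] .
  have "\<exists>s\<in>{-1<..<1}. f (p 1) - f (p (- 1)) =
      frechet_derivative f (at (p s)) (((1 - (- 1)) * (x $ i - \<xi> $ i)) *\<^sub>R axis i 1)"
    by (rule mvt_simple[of "-1" 1 "\<lambda>s. f (p s)"])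
      (auto intro: has_derivative_at_withinI deriv)
  then obtain s where s: "-1 < s" "s < 1" and eq: "f (p 1) - f (p (- 1)) =
      frechet_derivative f (at (p s)) ((2 * (x $ i - \<xi> $ i)) *\<^sub>R axis i 1)"
    by auto
  have "p 1 = x" "p (- 1) = reflect \<xi> i x"
    by (simp_all add: p_def reflect_def algebra_simps)
  with eq have "odd_part \<xi> i f x = (x $ i - \<xi> $ i) * partial i f (p s)"
    by (simp add: odd_part_def linear_frechet_derivative[OF f] linear_scale)
  moreover have "p s $ i - \<xi> $ i = s * (x $ i - \<xi> $ i)"
    by (simp add: p_def algebra_simps)
  then have "\<bar>p s $ i - \<xi> $ i\<bar> \<le> \<bar>x $ i - \<xi> $ i\<bar>"
    using s by (simp add: abs_mult mult_left_le_one_le)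
  moreover have "p s $ j = x $ j" if "j \<noteq> i" for j
    using that by (simp add: p_def axis_def)
  ultimately show ?thesis by blast
qed

text \<open>Induction on the list. The mean value theorem replaces the outermost odd part by a
  partial derivative, which commutes with the remaining odd parts because the coordinates are
  distinct. The intermediate point moves in coordinate \<open>i\<close> only, so the later factors
  are unaffected. The coordinatewise bound keeps \<open>z\<close> in every cube around
  \<open>\<xi>\<close> that contains \<open>x\<close>.\<close>

lemma odd_parts_mvt:
  assumes "Ck (length is) f" "distinct is"
  shows "\<exists>z. (\<forall>j. \<bar>z $ j - \<xi> $ j\<bar> \<le> \<bar>x $ j - \<xi> $ j\<bar>) \<and>
    foldr (odd_part \<xi>) is f x = (\<Prod>i\<in>set is. x $ i - \<xi> $ i) * mixed_partial is f z"
  using assms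
proof (induction "is" arbitrary: f x)
  case Nil
  then show ?case by auto
next
  case (Cons i "is")
  have f: "f differentiable (at x)" for x
    using Cons.prems by simp
  obtain y where y: "\<And>j. j \<noteq> i \<Longrightarrow> y $ j = x $ j" "\<bar>y $ i - \<xi> $ i\<bar> \<le> \<bar>x $ i - \<xi> $ i\<bar>"
    and eq: "foldr (odd_part \<xi>) (i # is) f x = (x $ i - \<xi> $ i) * foldr (odd_part \<xi>) is (partial i f) y"
    using odd_part_mvt[OF odd_parts_differentiable[OF f], of i x \<xi> \<xi> "is"] Cons.prems(2)
      fun_cong[OF partial_odd_parts[OF f], of i "is" \<xi>] by auto
  obtain z where z: "\<And>j. \<bar>z $ j - \<xi> $ j\<bar> \<le> \<bar>y $ j - \<xi> $ j\<bar>"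
    and eq': "foldr (odd_part \<xi>) is (partial i f) y
      = (\<Prod>i\<in>set is. y $ i - \<xi> $ i) * mixed_partial is (partial i f) z"
    using Cons.IH[of "partial i f" y] Cons.prems by auto
  have "(\<Prod>j\<in>set is. y $ j - \<xi> $ j) = (\<Prod>j\<in>set is. x $ j - \<xi> $ j)"
    using Cons.prems(2) by (intro prod.cong) (auto intro!: y(1))
  then have "foldr (odd_part \<xi>) (i # is) f x
      = (\<Prod>j\<in>set (i # is). x $ j - \<xi> $ j) * mixed_partial (i # is) f z"
    using Cons.prems(2) eq eq' by simp
  moreover have "\<bar>z $ j - \<xi> $ j\<bar> \<le> \<bar>x $ j - \<xi> $ j\<bar>" for j
    using z[of j] y by (cases "j = i") auto
  ultimately show ?case by blast
qed


section \<open>Even monomials on the cube and the normalization\<close>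

lemma nn_integral_lborel_prod_vec:
  fixes g :: "'n::finite \<Rightarrow> real \<Rightarrow> ennreal"
  assumes "\<And>i. g i \<in> borel_measurable borel"
  shows "(\<integral>\<^sup>+x. (\<Prod>i\<in>UNIV. g i (x $ i)) \<partial>lborel) = (\<Prod>i\<in>UNIV. \<integral>\<^sup>+y. g i y \<partial>lborel)"
proof -
  have prod_Basis: "(\<Prod>b\<in>Basis. h b) = (\<Prod>i\<in>UNIV. h (axis i 1))"
    for h :: "real ^ 'n \<Rightarrow> ennreal"
  proof -
    have "Basis = (\<lambda>i. axis i 1 :: real ^ 'n) ` UNIV"
      by (auto simp: Basis_vec_def)
    moreover have "inj (\<lambda>i. axis i 1 :: real ^ 'n)"
      by (auto simp: inj_def axis_eq_axis)
    ultimately show ?thesis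
      by (metis (no_types, lifting) prod.reindex_cong)
  qed
  show ?thesis
    using nn_integral_lborel_prod[of "\<lambda>b :: real ^ 'n. g (axis_index b)"] assms
    by (simp add: prod_Basis inner_axis)
qed

text \<open>Even exponents make the integrand nonnegative, so it can be treated as an
  \<open>ennreal\<close> integral, which factors over the coordinates.\<close>

lemma set_integral_cube_even_power:
  fixes \<xi> :: "real ^ 'n::finite"
  assumes "0 \<le> \<epsilon>" and even: "\<And>i. even (m i)"
  shows "(LINT x:cube \<xi> \<epsilon>|lborel. centred_power \<xi> m x) = (\<Prod>i\<in>UNIV. 2 * \<epsilon> ^ (m i + 1) / (m i + 1))"
proof -
  define g where "g i y = ennreal ((y - \<xi> $ i) ^ m i) * indicator {\<xi> $ i - \<epsilon>..\<xi> $ i + \<epsilon>} y" for i y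
  have nonneg: "0 \<le> (y - c) ^ m i" for y c :: real and i
    using even by (simp add: zero_le_power_eq)
  have split: "ennreal (indicator (cube \<xi> \<epsilon>) x * centred_power \<xi> m x) = (\<Prod>i\<in>UNIV. g i (x $ i))" for x
  proof (cases "x \<in> cube \<xi> \<epsilon>")
    case True
    then have "x $ i \<in> {\<xi> $ i - \<epsilon>..\<xi> $ i + \<epsilon>}" for i
      by (auto simp: cube_def mem_box_cart)
    then show ?thesis
      using True by (simp add: g_def centred_power_def prod_ennreal nonneg)
  next
    case False
    then obtain i where "x $ i \<notin> {\<xi> $ i - \<epsilon>..\<xi> $ i + \<epsilon>}"
      by (auto simp: cube_def mem_box_cart)
    then have "g i (x $ i) = 0"
      by (simp add: g_def)
    then have "(\<Prod>i\<in>UNIV. g i (x $ i)) = 0"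
      by (intro prod_zero) auto
    then show ?thesis
      using False by simp
  qed
  have one_dim: "(\<integral>\<^sup>+y. g i y \<partial>lborel) = ennreal (2 * \<epsilon> ^ (m i + 1) / (m i + 1))" for i
  proof -
    define F where "F y = (y - \<xi> $ i) ^ (m i + 1) / (m i + 1)" for y
    have "(\<integral>\<^sup>+y. g i y \<partial>lborel) = ennreal (F (\<xi> $ i + \<epsilon>) - F (\<xi> $ i - \<epsilon>))"
      unfolding g_def
    proof (rule nn_integral_FTC_Icc)
      show "(F has_real_derivative (y - \<xi> $ i) ^ m i) (at y)" for y
        unfolding F_def
        by (auto intro!: derivative_eq_intros simp del: power_Suc simp: add_eq_0_iff)
    qed (use assms nonneg in auto)
    \<comment> \<open>The exponent \<open>m i + 1\<close> is odd, so the two endpoint values are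
      opposite and their difference is twice the upper one.\<close>
    moreover have "F (\<xi> $ i + \<epsilon>) - F (\<xi> $ i - \<epsilon>) = 2 * \<epsilon> ^ (m i + 1) / (m i + 1)"
      using even[of i] by (simp add: F_def flip: diff_divide_distrib)
    ultimately show ?thesis by simp
  qed
  have "(LINT x:cube \<xi> \<epsilon>|lborel. centred_power \<xi> m x)
      = enn2real (\<integral>\<^sup>+x. ennreal (indicator (cube \<xi> \<epsilon>) x * centred_power \<xi> m x) \<partial>lborel)"
    unfolding set_lebesgue_integral_def real_scaleR_def
  proof (rule integral_eq_nn_integral)
    note [measurable] = borel_measurable_continuous_onI[OF continuous_on_centred_power]
    show "(\<lambda>x. indicat_real (cube \<xi> \<epsilon>) x * centred_power \<xi> m x) \<in> borel_measurable lborel"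
      by measurable
    show "AE x in lborel. 0 \<le> indicat_real (cube \<xi> \<epsilon>) x * centred_power \<xi> m x"
      by (simp add: centred_power_def prod_nonneg nonneg)
  qed
  also have "\<dots> = enn2real (\<Prod>i\<in>UNIV. ennreal (2 * \<epsilon> ^ (m i + 1) / (m i + 1)))"
    unfolding split one_dim[symmetric]
    by (subst nn_integral_lborel_prod_vec) (simp_all add: g_def[abs_def])
  also have "\<dots> = (\<Prod>i\<in>UNIV. 2 * \<epsilon> ^ (m i + 1) / (m i + 1))"
    using assms(1) by (simp add: prod_ennreal prod_nonneg)
  finally show ?thesis .
qed

lemma norm1_plus_eq_sum: "norm1_plus k = (\<Sum>i\<in>UNIV. k i + of_bool (odd (k i)))"
  by (simp add: norm1_plus_def sum.distrib of_bool_def sum.If_cases flip: Collect_conj_eq)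

text \<open>Round each exponent up to an even number \<open>m\<close>. The factor
  \<open>\<epsilon> ^ m / (m + 1)\<close> is the mean of \<open>y ^ m\<close> over the interval from
  \<open>- \<epsilon>\<close> to \<open>\<epsilon>\<close>, so the normalization is a moment of the
  uniform distribution on the cube.\<close>

lemma normalization_eq_prod:
  fixes k :: "'n::finite \<Rightarrow> nat"
  shows "normalization \<epsilon> k
    = (\<Prod>i\<in>UNIV. \<epsilon> ^ (k i + of_bool (odd (k i))) / (k i + of_bool (odd (k i)) + 1))"
proof -
  have "(\<Prod>i\<in>UNIV. 1 / (k i + of_bool (odd (k i)) + 1) :: real)
      = (\<Prod>i\<in>UNIV. if even (k i) then 1 / (real (k i) + 1) else 1 / (real (k i) + 2))"
    by (rule prod.cong) auto
  also have "\<dots> = (\<Prod>i | even (k i). 1 / (real (k i) + 1)) * (\<Prod>i | odd (k i). 1 / (real (k i) + 2))"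
    by (simp add: prod.If_cases Collect_neg_eq)
  finally have "normalization \<epsilon> k = (\<Prod>i\<in>UNIV. \<epsilon> ^ (k i + of_bool (odd (k i))))
      * (\<Prod>i\<in>UNIV. 1 / (k i + of_bool (odd (k i)) + 1))"
    by (simp add: normalization_def norm1_plus_eq_sum power_sum mult.assoc)
  then show ?thesis
    by (simp flip: prod.distrib)
qed

lemma normalization_pos: "0 < \<epsilon> \<Longrightarrow> 0 < normalization \<epsilon> k"
  unfolding normalization_eq_prod by (intro prod_pos) (auto intro!: divide_pos_pos)

lemma dist_le_of_mem_cube:
  fixes \<xi> :: "real ^ 'n::finite" and \<epsilon> :: real
  assumes "x \<in> cube \<xi> \<epsilon>"
  shows "dist x \<xi> \<le> CARD('n) * \<epsilon>"
proof -
  have "dist x \<xi> \<le> (\<Sum>i\<in>UNIV. \<bar>(x - \<xi>) $ i\<bar>)"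
    unfolding dist_norm by (rule norm_le_l1_cart)
  also have "\<dots> \<le> (\<Sum>i\<in>(UNIV :: 'n set). \<epsilon>)"
    using assms by (intro sum_mono) (simp add: cube_iff)
  finally show ?thesis by simp
qed

lemma continuous_mixed_partial:
  "Ck (length is) f \<Longrightarrow> continuous_on UNIV (mixed_partial is f)"
  by (induction "is" arbitrary: f) auto

text \<open>After passing to odd parts, the integrand is a nonnegative weight \<open>w\<close> times
  a mixed partial at some point of the cube. The denominator is exactly the integral of
  \<open>w\<close>, so the quotient is a weighted average of values that approach
  \<open>mixed_partial is f \<xi>\<close> by continuity.\<close>

lemma tendsto_cube_integral:
  fixes \<xi> :: "real ^ 'n::finite"
  assumes Ck: "Ck (length is) f" and "is": "distinct is" "set is = {i. odd (k i)}"
  shows "((\<lambda>\<epsilon>. cube_integral f \<xi> \<epsilon> k / ((2 * \<epsilon>) ^ CARD('n) * normalization \<epsilon> k))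
    \<longlongrightarrow> mixed_partial is f \<xi>) (at_right 0)"
proof (rule tendstoI)
  fix e :: real assume "0 < e"
  define c where "c = mixed_partial is f \<xi>"
  define F where "F = foldr (odd_part \<xi>) is f"
  \<comment> \<open>Each odd coordinate receives one more factor from \<open>odd_parts_mvt\<close>,
    which makes all exponents even and the weight nonnegative.\<close>
  define m where "m i = k i + of_bool (odd (k i))" for i
  define w where "w = centred_power \<xi> m"
  have even: "even (m i)" for i
    by (simp add: m_def)
  have w_nonneg: "0 \<le> w x" for x
    using even by (simp add: w_def centred_power_def prod_nonneg zero_le_power_eq)
  have w: "centred_power \<xi> k x * (\<Prod>i\<in>set is. x $ i - \<xi> $ i) = w x" for x
  proof -
    have "(\<Prod>i\<in>set is. x $ i - \<xi> $ i) = (\<Prod>i\<in>UNIV. (x $ i - \<xi> $ i) ^ of_bool (odd (k i)))"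
      unfolding "is"(2) by (rule prod.mono_neutral_cong_left) auto
    then show ?thesis
      by (simp add: w_def centred_power_def m_def power_add prod.distrib)
  qed
  have "continuous (at \<xi>) (mixed_partial is f)"
    using continuous_mixed_partial[OF Ck] by (simp add: continuous_on_eq_continuous_at)
  then obtain \<delta> where "0 < \<delta>" and \<delta>: "\<And>z. dist z \<xi> < \<delta> \<Longrightarrow> \<bar>mixed_partial is f z - c\<bar> < e / 2"
    using \<open>0 < e\<close> unfolding continuous_at_eps_delta c_def dist_real_def by (meson half_gt_zero)
  have small: "eventually (\<lambda>\<epsilon>::real. 0 < \<epsilon> \<and> CARD('n) * \<epsilon> < \<delta>) (at_right 0)"
    using \<open>0 < \<delta>\<close> by (auto simp: eventually_at_right_field field_simps intro!: exI[of _ "\<delta> / CARD('n)"])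
  show "eventually (\<lambda>\<epsilon>. dist (cube_integral f \<xi> \<epsilon> k / ((2 * \<epsilon>) ^ CARD('n) * normalization \<epsilon> k))
      (mixed_partial is f \<xi>) < e) (at_right 0)"
    using small
  proof eventually_elim
    case (elim \<epsilon>)
    define W where "W = (LINT x:cube \<xi> \<epsilon>|lborel. w x)"
    have W: "W = (2 * \<epsilon>) ^ CARD('n) * normalization \<epsilon> k"
    proof -
      have "W = (\<Prod>i\<in>UNIV. (2 * \<epsilon>) * (\<epsilon> ^ m i / (real (m i) + 1)))"
        using elim even unfolding W_def w_def
        by (simp add: set_integral_cube_even_power mult_ac add_ac)
      then show ?thesis
        by (simp only: prod.distrib normalization_eq_prod m_def prod_constant) (simp add: add_ac)
    qed
    then have "0 < W"
      using elim by (simp add: normalization_pos)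
    have cont: "continuous_on UNIV w" "continuous_on UNIV F" "continuous_on UNIV (centred_power \<xi> k)"
      using cube_integral_odd_parts(1)[OF Ck_imp_continuous[OF Ck]] "is"
      by (auto simp: w_def F_def continuous_on_centred_power)
    \<comment> \<open>The intermediate point \<open>z\<close> varies with \<open>x\<close>;
      eliminating it here leaves an inequality between continuous functions that can be
      integrated.\<close>
    have bound: "\<bar>centred_power \<xi> k x * F x - c * w x\<bar> \<le> e / 2 * w x" if x: "x \<in> cube \<xi> \<epsilon>" for x
    proof -
      obtain z where z: "\<And>j. \<bar>z $ j - \<xi> $ j\<bar> \<le> \<bar>x $ j - \<xi> $ j\<bar>"
        and F: "F x = (\<Prod>i\<in>set is. x $ i - \<xi> $ i) * mixed_partial is f z"
        using odd_parts_mvt[OF Ck "is"(1)] unfolding F_def by blast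
      have "z \<in> cube \<xi> \<epsilon>"
        using x z order_trans by (fastforce simp: cube_iff)
      then have "\<bar>mixed_partial is f z - c\<bar> \<le> e / 2"
        using dist_le_of_mem_cube[of z \<xi> \<epsilon>] elim \<delta>[of z] by simp
      from mult_right_mono[OF this w_nonneg[of x]]
      have "\<bar>mixed_partial is f z - c\<bar> * \<bar>w x\<bar> \<le> e / 2 * w x"
        by (simp only: abs_of_nonneg[OF w_nonneg])
      moreover have "centred_power \<xi> k x * F x - c * w x = (mixed_partial is f z - c) * w x"
        by (simp add: F flip: w) (simp add: algebra_simps)
      ultimately show ?thesis
        by (simp only: abs_mult)
    qed
    have J: "cube_integral f \<xi> \<epsilon> k = (LINT x:cube \<xi> \<epsilon>|lborel. centred_power \<xi> k x * F x)"
      using cube_integral_odd_parts(2)[OF Ck_imp_continuous[OF Ck], of "is" k \<xi> \<epsilon>] "is"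
      by (simp add: cube_integral_def F_def)
    have "cube_integral f \<xi> \<epsilon> k - c * W = (LINT x:cube \<xi> \<epsilon>|lborel. centred_power \<xi> k x * F x - c * w x)"
      unfolding J by (subst set_integral_diff) (auto intro!: set_integrable_cube continuous_intros cont simp: W_def)
    also have "\<bar>\<dots>\<bar> \<le> (LINT x:cube \<xi> \<epsilon>|lborel. \<bar>centred_power \<xi> k x * F x - c * w x\<bar>)"
      using integral_norm_bound[of lborel
          "\<lambda>x. indicator (cube \<xi> \<epsilon>) x *\<^sub>R (centred_power \<xi> k x * F x - c * w x)"]
      by (simp add: set_lebesgue_integral_def abs_mult)
    also have "\<dots> \<le> (LINT x:cube \<xi> \<epsilon>|lborel. e / 2 * w x)"
      by (intro set_integral_mono set_integrable_cube continuous_intros cont bound)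
    also have "\<dots> = e / 2 * W"
      by (simp add: W_def)
    finally have "\<bar>cube_integral f \<xi> \<epsilon> k / W - c\<bar> \<le> e / 2"
      using \<open>0 < W\<close> by (simp add: field_simps abs_le_iff)
    then show ?case
      using \<open>0 < e\<close> by (simp add: dist_real_def c_def W)
  qed
qed

section \<open>Limits of normalized moments\<close>

lemma local_moment_eq:
  fixes X :: "'a \<Rightarrow> real ^ 'n::finite"
  assumes "prob_space M" and D: "distributed M lborel X (\<lambda>x. ennreal (f x))" and f: "\<And>x. 0 < f x"
  shows "local_moment M X \<xi> \<epsilon> k = cube_integral f \<xi> \<epsilon> k / cube_integral f \<xi> \<epsilon> (\<lambda>_. 0)"
proof -
  interpret prob_space M by fact
  let ?B = "{\<omega> \<in> space M. X \<omega> \<in> cube \<xi> \<epsilon>}"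
  have [measurable]: "X \<in> borel_measurable M"
    using distributed_measurable[OF D] by simp
  note [measurable] = borel_measurable_continuous_onI[OF continuous_on_centred_power]
  \<comment> \<open>Proved for every exponent, since exponent zero yields the probability of the
    conditioning event.\<close>
  have moment: "(LINT \<omega>:?B|M. centred_power \<xi> k (X \<omega>)) = cube_integral f \<xi> \<epsilon> k" for k
  proof -
    have "(LINT \<omega>:?B|M. centred_power \<xi> k (X \<omega>))
        = (LINT \<omega>|M. indicator (cube \<xi> \<epsilon>) (X \<omega>) * centred_power \<xi> k (X \<omega>))"
      unfolding set_lebesgue_integral_def
      by (intro Bochner_Integration.integral_cong) (auto simp: indicator_def)
    also have "\<dots> = (LINT x|lborel. f x * (indicator (cube \<xi> \<epsilon>) x * centred_power \<xi> k x))"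
      by (subst distributed_integral[OF D, symmetric]) (auto intro!: less_imp_le f)
    finally show ?thesis
      by (simp add: cube_integral_def set_lebesgue_integral_def mult_ac)
  qed
  have "measure M ?B = cube_integral f \<xi> \<epsilon> (\<lambda>_. 0)"
    unfolding moment[symmetric] 
    by (simp add: centred_power_def set_lebesgue_integral_def Int_absorb2)
  then show ?thesis
    using moment[of k] by (simp add: local_moment_def centred_power_def)
qed

text \<open>Divide the asymptotics for \<open>k\<close> by those for exponent zero; the volume of
  the cube cancels.\<close>

lemma tendsto_local_moment:
  fixes X :: "'a \<Rightarrow> real ^ 'n::finite"
  assumes M: "prob_space M" "distributed M lborel X (\<lambda>x. ennreal (f x))" "\<And>x. 0 < f x"
    and Ck: "Ck (length is) f" and "is": "distinct is" "set is = {i. odd (k i)}"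
  shows "((\<lambda>\<epsilon>. local_moment M X \<xi> \<epsilon> k / normalization \<epsilon> k)
    \<longlongrightarrow> mixed_partial is f \<xi> / f \<xi>) (at_right 0)"
proof (rule Lim_transform_eventually)
  let ?c = "\<lambda>\<epsilon> :: real. (2 * \<epsilon>) ^ CARD('n)"
  have "Ck (length []) f"
    using Ck_imp_continuous[OF Ck] by simp
  from tendsto_cube_integral[OF this, of "\<lambda>_. 0" \<xi>]
  have "((\<lambda>\<epsilon>. cube_integral f \<xi> \<epsilon> (\<lambda>_. 0) / ?c \<epsilon>) \<longlongrightarrow> f \<xi>) (at_right 0)"
    by (simp add: normalization_eq_prod)
  from tendsto_divide[OF tendsto_cube_integral[OF Ck "is"] this]
  show "((\<lambda>\<epsilon>. (cube_integral f \<xi> \<epsilon> k / (?c \<epsilon> * normalization \<epsilon> k)) / (cube_integral f \<xi> \<epsilon> (\<lambda>_. 0) / ?c \<epsilon>))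
      \<longlongrightarrow> mixed_partial is f \<xi> / f \<xi>) (at_right 0)"
    using M(3)[of \<xi>] by simp
  show "eventually (\<lambda>\<epsilon>. (cube_integral f \<xi> \<epsilon> k / (?c \<epsilon> * normalization \<epsilon> k)) / (cube_integral f \<xi> \<epsilon> (\<lambda>_. 0) / ?c \<epsilon>)
      = local_moment M X \<xi> \<epsilon> k / normalization \<epsilon> k) (at_right 0)"
    using eventually_at_right_less[of "0 :: real"]
    by eventually_elim (simp add: local_moment_eq[OF M])
qed

lemma Ck_Suc_imp: "Ck (Suc n) f \<Longrightarrow> Ck n f"
  by (induction n arbitrary: f) (auto intro: Ck_imp_continuous[of 1])

lemma Ck_mono:
  assumes "Ck n f" "m \<le> n"
  shows "Ck m f"
  using assms(2,1)
proof (induction rule: dec_induct)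
  case (step n)
  show ?case
    by (rule step.IH[OF Ck_Suc_imp[OF step.prems]])
qed

text \<open>At most \<open>CARD('n)\<close> coordinates are odd, so the smoothness assumption covers
  the mixed partial. Convergence then gives the \<open>Lim\<close> in
  \<open>differential_moment\<close> its meaning.\<close>

lemma tendsto_differential_moment:
  fixes X :: "'a \<Rightarrow> real ^ 'n::finite"
  assumes "prob_space M" "distributed M lborel X (\<lambda>x. ennreal (f x))" "\<And>x. 0 < f x"
    and Ck: "Ck (CARD('n) + 1) f"
  shows "((\<lambda>\<epsilon>. local_moment M X \<xi> \<epsilon> k / normalization \<epsilon> k)
    \<longlongrightarrow> differential_moment M X \<xi> k) (at_right 0)"
proof -
  obtain "is" where "is": "distinct is" "set is = {i. odd (k i)}"
    using finite_distinct_list[of "{i. odd (k i)}"] by auto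
  have "length is \<le> CARD('n)"
    using distinct_card[OF "is"(1)] card_mono[of UNIV "set is"] by simp
  then have "Ck (length is) f"
    by (intro Ck_mono[OF Ck]) simp
  note lim = tendsto_local_moment[OF assms(1-3) this "is"]
  show ?thesis
    unfolding differential_moment_def tendsto_Lim[OF trivial_limit_at_right_real lim] by (rule lim)
qed

section \<open>From moments to cumulants\<close>

definition normalization_const :: "('n::finite \<Rightarrow> nat) \<Rightarrow> real" where
  "normalization_const k = (\<Prod>i | even (k i). 1 / (real (k i) + 1)) * (\<Prod>i | odd (k i). 1 / (real (k i) + 2))"

lemma normalization_eq_const: "normalization \<epsilon> k = normalization_const k * \<epsilon> ^ norm1_plus k"
  by (simp add: normalization_def normalization_const_def)

definition partition_ratio :: "'n::finite multiset multiset \<Rightarrow> real \<Rightarrow> real" where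
  "partition_ratio \<pi> \<epsilon> = (\<Prod>B\<in>#\<pi>. normalization \<epsilon> (count B)) / normalization \<epsilon> (count (\<Sum>\<^sub># \<pi>))"

text \<open>Rounding up to an even number is subadditive in each coordinate. Hence the exponent of
  \<open>\<epsilon>\<close> in \<open>partition_ratio\<close> is never negative, and natural-number
  subtraction computes it correctly.\<close>

lemma norm1_plus_subadditive: "norm1_plus (count (\<Sum>\<^sub># \<pi>)) \<le> (\<Sum>B\<in>#\<pi>. norm1_plus (count B))"
proof (induction \<pi>)
  case empty
  then show ?case by (simp add: norm1_plus_def)
next
  case (add B \<pi>)
  have "norm1_plus (count (B + \<Sum>\<^sub># \<pi>)) \<le> norm1_plus (count B) + norm1_plus (count (\<Sum>\<^sub># \<pi>))"
    unfolding norm1_plus_eq_sum sum.distrib[symmetric] by (rule sum_mono) auto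
  then show ?case
    using add unfolding image_mset_add_mset sum_mset.add_mset by linarith
qed

text \<open>The power of 0 distinguishes the partitions of leading order, where the exponent is 0 and
  \<open>0 ^ 0 = 1\<close>, from the vanishing ones.\<close>

definition partition_ratio_lim :: "'n::finite multiset multiset \<Rightarrow> real" where
  "partition_ratio_lim \<pi> = (\<Prod>B\<in>#\<pi>. normalization_const (count B)) / normalization_const (count (\<Sum>\<^sub># \<pi>))
    * 0 ^ ((\<Sum>B\<in>#\<pi>. norm1_plus (count B)) - norm1_plus (count (\<Sum>\<^sub># \<pi>)))"

text \<open>For positive \<open>\<epsilon>\<close> the ratio is a constant times a power of
  \<open>\<epsilon>\<close> with natural exponent, and such a function is continuous at 0.\<close>

lemma tendsto_partition_ratio: "(partition_ratio \<pi> \<longlongrightarrow> partition_ratio_lim \<pi>) (at_right 0)"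
proof (rule Lim_transform_eventually)
  let ?K = "(\<Prod>B\<in>#\<pi>. normalization_const (count B)) / normalization_const (count (\<Sum>\<^sub># \<pi>))"
  let ?d = "(\<Sum>B\<in>#\<pi>. norm1_plus (count B)) - norm1_plus (count (\<Sum>\<^sub># \<pi>))"
  show "((\<lambda>\<epsilon>. ?K * \<epsilon> ^ ?d) \<longlongrightarrow> partition_ratio_lim \<pi>) (at_right 0)"
    unfolding partition_ratio_lim_def by (intro tendsto_intros)
  have prod: "(\<Prod>B\<in>#\<pi>. normalization \<epsilon> (count B))
      = (\<Prod>B\<in>#\<pi>. normalization_const (count B)) * \<epsilon> ^ (\<Sum>B\<in>#\<pi>. norm1_plus (count B))" for \<epsilon>
    by (induction \<pi>) (simp_all add: normalization_eq_const power_add)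
  show "eventually (\<lambda>\<epsilon>. ?K * \<epsilon> ^ ?d = partition_ratio \<pi> \<epsilon>) (at_right 0)"
    using eventually_at_right_less[of "0 :: real"]
    by eventually_elim (simp add: partition_ratio_def prod normalization_eq_const[of _ "count (\<Sum>\<^sub># \<pi>)"]
        power_diff norm1_plus_subadditive)
qed

text \<open>Each coordinate occurs in at most one block and the other blocks contribute a factor 1
  there, so the normalization is multiplicative over the blocks. The ratio is thus constantly 1, and
  uniqueness of limits gives the value.\<close>

lemma partition_ratio_lim_binary:
  fixes \<pi> :: "'n::finite multiset multiset"
  assumes "\<And>i. count (\<Sum>\<^sub># \<pi>) i \<le> 1"
  shows "partition_ratio_lim \<pi> = 1"
proof -
  have prod: "(\<Prod>B\<in>#\<pi>. normalization \<epsilon> (count B)) = normalization \<epsilon> (count (\<Sum>\<^sub># \<pi>))" for \<epsilon>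
    using assms
  proof (induction \<pi>)
    case (add B \<pi>)
    have le: "count B i + count (\<Sum>\<^sub># \<pi>) i \<le> 1" for i
      using add.prems[of i] by simp
    then have "count (\<Sum>\<^sub># \<pi>) i \<le> 1" for i
      using add_leD2 by blast
    note IH = add.IH[OF this]
    have zero: "count B i = 0 \<or> count (\<Sum>\<^sub># \<pi>) i = 0" for i
      using le[of i] by linarith
    \<comment> \<open>The contribution of a single coordinate. As \<open>h 0 = 1\<close> and one of
      the two counts is 0, \<open>h\<close> turns their sum into a product.\<close>
    define h :: "nat \<Rightarrow> real" where "h a = \<epsilon> ^ (a + of_bool (odd a)) / (a + of_bool (odd a) + 1)" for a
    have norm: "normalization \<epsilon> k = (\<Prod>i\<in>UNIV. h (k i))" for k :: "'n \<Rightarrow> nat"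
      by (simp add: normalization_eq_prod h_def)
    have "h (count B i) * h (count (\<Sum>\<^sub># \<pi>) i) = h (count B i + count (\<Sum>\<^sub># \<pi>) i)" for i
      using zero[of i] by (auto simp: h_def)
    then have "normalization \<epsilon> (count B) * normalization \<epsilon> (count (\<Sum>\<^sub># \<pi>))
        = normalization \<epsilon> (count (B + \<Sum>\<^sub># \<pi>))"
      by (simp add: norm flip: prod.distrib)
    then show ?case
      by (simp only: image_mset_add_mset prod_mset.add_mset sum_mset.add_mset IH)
  qed (simp add: normalization_eq_prod)
  have "partition_ratio \<pi> \<epsilon> = 1" if "0 < \<epsilon>" for \<epsilon>
    unfolding partition_ratio_def prod using normalization_pos[OF that, of "count (\<Sum>\<^sub># \<pi>)"] by simp
  then have "eventually (\<lambda>\<epsilon>. partition_ratio \<pi> \<epsilon> = 1) (at_right 0)"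
    using eventually_at_right_less[of "0 :: real"] by (auto elim: eventually_mono)
  then have "(partition_ratio \<pi> \<longlongrightarrow> 1) (at_right 0)"
    by (rule tendsto_eventually)
  then show ?thesis
    using tendsto_unique[OF trivial_limit_at_right_real tendsto_partition_ratio] by metis
qed

text \<open>Rewriting each moment as its normalization times the normalized moment collects all
  normalizations of a term into \<open>partition_ratio\<close>; the finite sum then converges term
  by term.\<close>

lemma tendsto_local_cumulant:
  fixes X :: "'a \<Rightarrow> real ^ 'n::finite"
  assumes lim: "\<And>k. ((\<lambda>\<epsilon>. local_moment M X \<xi> \<epsilon> k / normalization \<epsilon> k)
    \<longlongrightarrow> differential_moment M X \<xi> k) (at_right 0)"
  shows "((\<lambda>\<epsilon>. 1 / normalization \<epsilon> k * local_cumulant M X \<xi> \<epsilon> k) \<longlongrightarrow>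
    (\<Sum>\<pi>\<in>multiset_partitions k. collapse_number \<pi> * (- 1) ^ (size \<pi> - 1) * fact (size \<pi> - 1) *
      (partition_ratio_lim \<pi> * (\<Prod>B\<in>#\<pi>. differential_moment M X \<xi> (count B))))) (at_right 0)"
proof (rule Lim_transform_eventually)
  have prod: "((\<lambda>\<epsilon>. \<Prod>B\<in>#\<pi>. local_moment M X \<xi> \<epsilon> (count B) / normalization \<epsilon> (count B))
      \<longlongrightarrow> (\<Prod>B\<in>#\<pi>. differential_moment M X \<xi> (count B))) (at_right 0)" for \<pi>
    by (induction \<pi>) (simp_all add: tendsto_mult lim del: times_divide_eq_left times_divide_eq_right)
  let ?a = "\<lambda>\<epsilon>. \<Sum>\<pi>\<in>multiset_partitions k. collapse_number \<pi> * (- 1) ^ (size \<pi> - 1) * fact (size \<pi> - 1) *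
      (partition_ratio \<pi> \<epsilon> * (\<Prod>B\<in>#\<pi>. local_moment M X \<xi> \<epsilon> (count B) / normalization \<epsilon> (count B)))"
  show "(?a \<longlongrightarrow> (\<Sum>\<pi>\<in>multiset_partitions k. collapse_number \<pi> * (- 1) ^ (size \<pi> - 1) * fact (size \<pi> - 1) *
      (partition_ratio_lim \<pi> * (\<Prod>B\<in>#\<pi>. differential_moment M X \<xi> (count B))))) (at_right 0)"
    by (intro tendsto_intros tendsto_partition_ratio prod)
  show "eventually (\<lambda>\<epsilon>. ?a \<epsilon> = 1 / normalization \<epsilon> k * local_cumulant M X \<xi> \<epsilon> k) (at_right 0)"
    using eventually_at_right_less[of "0 :: real"]
  proof eventually_elim
    case (elim \<epsilon>)
    have ne: "normalization \<epsilon> k \<noteq> 0" for k :: "'n \<Rightarrow> nat"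
      using normalization_pos[OF elim] by (metis less_irrefl)
    have split: "(\<Prod>B\<in>#\<pi>. local_moment M X \<xi> \<epsilon> (count B)) = (\<Prod>B\<in>#\<pi>. normalization \<epsilon> (count B)) *
        (\<Prod>B\<in>#\<pi>. local_moment M X \<xi> \<epsilon> (count B) / normalization \<epsilon> (count B))" for \<pi>
      by (induction \<pi>) (simp_all add: ne)
    show ?case
      unfolding local_cumulant_def cumulant_of_moments_def sum_distrib_left split
      by (rule sum.cong) (auto simp: partition_ratio_def multiset_partitions_def)
  qed
qed

lemma cumulant_limit_identity_binary:
  fixes k :: "'n::finite \<Rightarrow> nat"
  assumes "\<And>i. k i \<le> 1"
  shows "cumulant_limit_identity TYPE('a) k"
  unfolding cumulant_limit_identity_def
proof (intro allI impI)
  fix M :: "'a measure" and X :: "'a \<Rightarrow> real ^ 'n" and f \<xi>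
  assume "prob_space M" "distributed M lborel X (\<lambda>x. ennreal (f x))" "\<forall>x. 0 < f x" "Ck (CARD('n) + 1) f"
  then have "((\<lambda>\<epsilon>. local_moment M X \<xi> \<epsilon> k / normalization \<epsilon> k)
      \<longlongrightarrow> differential_moment M X \<xi> k) (at_right 0)" for k
    by (intro tendsto_differential_moment) auto
  note tendsto_local_cumulant[OF this, of k]
  also have "(\<Sum>\<pi>\<in>multiset_partitions k. collapse_number \<pi> * (- 1) ^ (size \<pi> - 1) * fact (size \<pi> - 1) *
      (partition_ratio_lim \<pi> * (\<Prod>B\<in>#\<pi>. differential_moment M X \<xi> (count B))))
      = differential_cumulant M X \<xi> k"
    unfolding differential_cumulant_def cumulant_of_moments_def
    using assms by (intro sum.cong) (auto simp: multiset_partitions_def partition_ratio_lim_binary)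
  finally show "((\<lambda>\<epsilon>. 1 / normalization \<epsilon> k * local_cumulant M X \<xi> \<epsilon> k)
      \<longlongrightarrow> differential_cumulant M X \<xi> k) (at_right 0)" .
qed

section \<open>A density with prescribed differential moments\<close>

text \<open>Allows an explicit derivative in place of \<open>frechet_derivative\<close>, so that
  smoothness follows by induction on the order.\<close>

lemma Ck_SucI:
  assumes "\<And>x. (f has_derivative D x) (at x)" and "\<And>v. Ck n (\<lambda>x. D x v)"
  shows "Ck (Suc n) f"
  using assms frechet_derivative_at[OF assms(1)] by (auto intro: differentiableI)

lemma Ck_const: "Ck n (\<lambda>x. c)"
  by (induction n arbitrary: c) simp_all

lemma Ck_add:
  assumes "Ck n f" "Ck n g"
  shows "Ck n (\<lambda>x. f x + g x)"
  using assms
proof (induction n arbitrary: f g)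
  case 0
  then show ?case by (simp add: continuous_on_add)
next
  case (Suc n)
  show ?case
    by (rule Ck_SucI[where D = "\<lambda>x v. frechet_derivative f (at x) v + frechet_derivative g (at x) v"])
      (use Suc in \<open>auto intro!: has_derivative_add simp flip: frechet_derivative_works\<close>)
qed

text \<open>By the Leibniz rule the derivative is a sum of products of functions of class
  \<open>Ck n\<close>; the undifferentiated factors are lowered to that class by
  \<open>Ck_Suc_imp\<close>.\<close>

lemma Ck_mult:
  assumes "Ck n f" "Ck n g"
  shows "Ck n (\<lambda>x. f x * g x)"
  using assms
proof (induction n arbitrary: f g)
  case 0
  then show ?case by (simp add: continuous_on_mult)
next
  case (Suc n)
  show ?case
  proof (rule Ck_SucI)
    show "((\<lambda>x. f x * g x) has_derivative
        (\<lambda>v. f x * frechet_derivative g (at x) v + frechet_derivative f (at x) v * g x)) (at x)" for x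
      using Suc.prems by (intro has_derivative_mult) (auto simp flip: frechet_derivative_works)
    show "Ck n (\<lambda>x. f x * frechet_derivative g (at x) v + frechet_derivative f (at x) v * g x)" for v
      using Suc.prems Suc.prems[THEN Ck_Suc_imp] by (intro Ck_add Suc.IH) auto
  qed
qed

lemma Ck_sum: "(\<And>i. i \<in> I \<Longrightarrow> Ck n (f i)) \<Longrightarrow> Ck n (\<lambda>x. \<Sum>i\<in>I. f i x)"
  by (induction I rule: infinite_finite_induct) (simp_all add: Ck_const Ck_add)

lemma Ck_prod: "(\<And>i. i \<in> I \<Longrightarrow> Ck n (f i)) \<Longrightarrow> Ck n (\<lambda>x. \<Prod>i\<in>I. f i x)"
  by (induction I rule: infinite_finite_induct) (simp_all add: Ck_const Ck_mult)

lemma nth_has_derivative: "((\<lambda>x. x $ i) has_derivative (\<lambda>v. v $ i)) F"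
  by (rule bounded_linear.has_derivative[OF bounded_linear_vec_nth has_derivative_ident])

lemma Ck_nth: "Ck n (\<lambda>x :: real ^ 'n::finite. x $ i)"
proof (cases n)
  case 0
  then show ?thesis by (auto intro: continuous_intros)
next
  case (Suc m)
  then show ?thesis
    using Ck_SucI[OF nth_has_derivative Ck_const] by blast
qed

text \<open>Each function has the other as its derivative up to sign, hence the simultaneous
  induction.\<close>

lemma Ck_sin_cos_nth:
  "Ck n (\<lambda>x :: real ^ 'n::finite. sin (x $ i)) \<and> Ck n (\<lambda>x :: real ^ 'n. cos (x $ i))"
proof (induction n)
  case 0
  show ?case by (auto intro!: continuous_intros)
next
  case (Suc n)
  have "Ck (Suc n) (\<lambda>x :: real ^ 'n. sin (x $ i))"
    by (rule Ck_SucI[where D = "\<lambda>x v. v $ i * cos (x $ i)"])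
      (auto intro!: derivative_eq_intros nth_has_derivative Ck_mult Ck_const Suc[THEN conjunct2])
  moreover have "Ck (Suc n) (\<lambda>x :: real ^ 'n. cos (x $ i))"
  proof (rule Ck_SucI)
    show "((\<lambda>x. cos (x $ i)) has_derivative (\<lambda>v. (- v $ i) * sin (x $ i))) (at x)" for x :: "real ^ 'n"
      by (auto intro!: derivative_eq_intros nth_has_derivative)
    show "Ck n (\<lambda>x :: real ^ 'n. (- v $ i) * sin (x $ i))" for v :: "real ^ 'n"
      by (intro Ck_mult Ck_const Suc[THEN conjunct1])
  qed
  ultimately show ?case by blast
qed

lemma std_normal_density_has_derivative:
  "((\<lambda>x. std_normal_density (x $ i)) has_derivative
    (\<lambda>v. - v $ i * (x $ i * std_normal_density (x $ i)))) (at x)"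
proof -
  have "((\<lambda>x. c * exp (- (x $ i)\<^sup>2 / 2)) has_derivative
      (\<lambda>v. - v $ i * (x $ i * (c * exp (- (x $ i)\<^sup>2 / 2))))) (at x)" for c
    by (auto intro!: derivative_eq_intros nth_has_derivative)
  then show ?thesis
    unfolding std_normal_density_def .
qed

lemma Ck_std_normal_density_nth: "Ck n (\<lambda>x :: real ^ 'n::finite. std_normal_density (x $ i))"
proof (induction n)
  case 0
  show ?case
    unfolding std_normal_density_def by (auto intro!: continuous_intros)
next
  case (Suc n)
  show ?case
    by (rule Ck_SucI[OF std_normal_density_has_derivative]) (intro Ck_mult Ck_const Ck_nth Suc)
qed

section \<open>The tilted Gaussian: positivity, total mass and moments at the origin\<close>

definition std_gaussian :: "real ^ 'n::finite \<Rightarrow> real" where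
  "std_gaussian x = (\<Prod>i\<in>UNIV. std_normal_density (x $ i))"

text \<open>The sine is bounded, which keeps the density positive for small \<open>t\<close>; it is
  odd, which keeps the total mass 1 for every such \<open>t\<close>; and it has slope 1 at the
  origin, which makes the first-order moments there equal to \<open>t\<close>.\<close>

definition tilted_gaussian :: "real \<Rightarrow> real ^ 'n::finite \<Rightarrow> real" where
  "tilted_gaussian t x = std_gaussian x * (1 + t * (\<Sum>i\<in>UNIV. sin (x $ i)))"

lemma Ck_std_gaussian: "Ck n std_gaussian"
  unfolding std_gaussian_def[abs_def] by (intro Ck_prod Ck_std_normal_density_nth)

lemma Ck_tilted_gaussian: "Ck n (tilted_gaussian t)"
  unfolding tilted_gaussian_def[abs_def]
  by (intro Ck_mult Ck_std_gaussian Ck_add Ck_const Ck_sum Ck_sin_cos_nth[THEN conjunct1])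

lemma std_gaussian_pos: "0 < std_gaussian x"
  by (simp add: std_gaussian_def prod_pos normal_density_pos)

lemma tilted_gaussian_pos:
  fixes x :: "real ^ 'n::finite"
  assumes "0 < t" "t < 1 / CARD('n)"
  shows "0 < tilted_gaussian t x"
proof -
  have "- real CARD('n) \<le> (\<Sum>i\<in>UNIV. sin (x $ i))"
    using sum_mono[of UNIV "\<lambda>_ :: 'n. - 1 :: real" "\<lambda>i. sin (x $ i)"] by simp
  from mult_left_mono[OF this, of t] have "- (t * CARD('n)) \<le> t * (\<Sum>i\<in>UNIV. sin (x $ i))"
    using assms by simp
  moreover have "t * CARD('n) < 1"
    using assms by (simp add: field_simps)
  ultimately show ?thesis
    by (simp add: tilted_gaussian_def std_gaussian_pos)
qed

lemma std_gaussian_reflect: "std_gaussian (reflect 0 i x) = std_gaussian x"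
  unfolding std_gaussian_def by (intro prod.cong) (auto simp: reflect_nth std_normal_density_def)

lemma has_bochner_integral_std_gaussian: "has_bochner_integral lborel (std_gaussian :: real ^ 'n::finite \<Rightarrow> real) 1"
proof (rule has_bochner_integral_nn_integral)
  show "std_gaussian \<in> borel_measurable lborel"
    using borel_measurable_continuous_onI[OF Ck_imp_continuous[OF Ck_std_gaussian]] by simp
  have "(\<integral>\<^sup>+x. ennreal (std_gaussian (x :: real ^ 'n)) \<partial>lborel)
      = (\<integral>\<^sup>+x. (\<Prod>i\<in>UNIV. ennreal (std_normal_density ((x :: real ^ 'n) $ i))) \<partial>lborel)"
    by (simp add: std_gaussian_def prod_ennreal)
  also have "\<dots> = (\<Prod>i\<in>(UNIV :: 'n set). \<integral>\<^sup>+y. ennreal (std_normal_density y) \<partial>lborel)"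
    by (rule nn_integral_lborel_prod_vec) simp
  also have "(\<integral>\<^sup>+y. ennreal (std_normal_density y) \<partial>lborel) = 1"
    by (simp add: nn_integral_eq_integral)
  finally show "(\<integral>\<^sup>+x. ennreal (std_gaussian (x :: real ^ 'n)) \<partial>lborel) = ennreal 1"
    by simp
qed (auto intro: less_imp_le std_gaussian_pos)

text \<open>The integrand is dominated by the Gaussian and changes sign under reflection in
  coordinate \<open>i\<close>, so its integral equals its own negative.\<close>

lemma has_bochner_integral_std_gaussian_sin:
  "has_bochner_integral lborel (\<lambda>x :: real ^ 'n::finite. std_gaussian x * sin (x $ i)) 0"
proof -
  have "Ck 0 (\<lambda>x :: real ^ 'n. std_gaussian x * sin (x $ i))"
    by (intro Ck_mult Ck_std_gaussian Ck_sin_cos_nth[THEN conjunct1])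
  then have meas: "(\<lambda>x :: real ^ 'n. std_gaussian x * sin (x $ i)) \<in> borel_measurable borel"
    by (intro borel_measurable_continuous_onI Ck_imp_continuous)
  have "integrable lborel (\<lambda>x :: real ^ 'n. std_gaussian x * sin (x $ i))"
  proof (rule Bochner_Integration.integrable_bound)
    show "integrable lborel (std_gaussian :: real ^ 'n \<Rightarrow> real)"
      using has_bochner_integral_std_gaussian by (rule integrable.intros)
    show "AE x :: real ^ 'n in lborel. norm (std_gaussian x * sin (x $ i)) \<le> norm (std_gaussian x)"
      by (simp add: abs_mult mult_left_le)
  qed (use meas in simp)
  moreover have "(LINT x|lborel. std_gaussian (x :: real ^ 'n) * sin (x $ i)) = 0"
    using integral_reflect[OF meas, of 0 i] by (simp add: std_gaussian_reflect reflect_nth)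
  ultimately show ?thesis
    by (simp add: has_bochner_integral_iff)
qed

lemma prob_space_tilted_gaussian:
  assumes "0 < t" "t < 1 / CARD('n)"
  shows "prob_space (density lborel (\<lambda>x :: real ^ 'n::finite. ennreal (tilted_gaussian t x)))"
proof
  have "has_bochner_integral lborel
      (\<lambda>x :: real ^ 'n. std_gaussian x + (\<Sum>i\<in>UNIV. t * (std_gaussian x * sin (x $ i)))) (1 + (\<Sum>i\<in>(UNIV :: 'n set). t * 0))"
    by (intro has_bochner_integral_add has_bochner_integral_std_gaussian has_bochner_integral_sum
        has_bochner_integral_mult_right has_bochner_integral_std_gaussian_sin)
  then have int: "has_bochner_integral lborel (tilted_gaussian t :: real ^ 'n \<Rightarrow> real) 1"
    by (simp add: tilted_gaussian_def[abs_def] algebra_simps sum_distrib_left)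
  then have [measurable]: "(tilted_gaussian t :: real ^ 'n \<Rightarrow> real) \<in> borel_measurable lborel"
    by (rule borel_measurable_has_bochner_integral)
  show "emeasure (density lborel (\<lambda>x :: real ^ 'n. ennreal (tilted_gaussian t x)))
      (space (density lborel (\<lambda>x :: real ^ 'n. ennreal (tilted_gaussian t x)))) = 1"
    using int
    by (simp add: emeasure_density nn_integral_eq_integral has_bochner_integral_iff tilted_gaussian_pos[OF assms] less_imp_le)
qed

lemma distributed_tilted_gaussian:
  "distributed (density lborel (\<lambda>x. ennreal (tilted_gaussian t x))) lborel (\<lambda>x. x)
    (\<lambda>x :: real ^ 'n::finite. ennreal (tilted_gaussian t x))"
proof -
  have "(tilted_gaussian t :: real ^ 'n \<Rightarrow> real) \<in> borel_measurable borel"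
    by (intro borel_measurable_continuous_onI Ck_imp_continuous[of 0] Ck_tilted_gaussian)
  then show ?thesis
    by (simp add: distributed_def distr_id2)
qed

text \<open>The Gaussian factor is even in every coordinate, and reflection in coordinate
  \<open>i\<close> alters only the i-th sine.\<close>

lemma odd_part_tilted_gaussian:
  fixes i :: "'n::finite"
  shows "odd_part 0 i (tilted_gaussian t) = (\<lambda>x. t * (std_gaussian x * sin (x $ i)))"
proof
  fix x :: "real ^ 'n"
  have "(\<Sum>j\<in>UNIV. sin (x $ j)) - (\<Sum>j\<in>UNIV. sin (reflect 0 i x $ j))
      = (\<Sum>j\<in>UNIV. if j = i then 2 * sin (x $ i) else 0)"
    unfolding sum_subtractf[symmetric] by (rule sum.cong) (auto simp: reflect_nth)
  then have sum: "(\<Sum>j\<in>UNIV. sin (reflect 0 i x $ j)) = (\<Sum>j\<in>UNIV. sin (x $ j)) - 2 * sin (x $ i)"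
    by simp
  show "odd_part 0 i (tilted_gaussian t) x = t * (std_gaussian x * sin (x $ i))"
    unfolding odd_part_def tilted_gaussian_def std_gaussian_reflect sum by (simp add: field_simps)
qed

text \<open>The odd part in coordinate \<open>i\<close> is even in coordinate \<open>j\<close>, so a
  second odd part annihilates it. The moment is therefore 0 for each \<open>\<epsilon>\<close>, not
  merely in the limit.\<close>

lemma cube_integral_tilted_gaussian:
  fixes k :: "'n::finite \<Rightarrow> nat"
  assumes "odd (k i)" "odd (k j)" "i \<noteq> j"
  shows "cube_integral (tilted_gaussian t) 0 \<epsilon> k = 0"
proof -
  have zero: "odd_part 0 j (odd_part 0 i (tilted_gaussian t)) = (\<lambda>_ :: real ^ 'n. 0)"
    using assms(3) unfolding odd_part_tilted_gaussian
    by (simp add: fun_eq_iff odd_part_def std_gaussian_reflect reflect_nth)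
  have cont: "continuous_on UNIV (tilted_gaussian t :: real ^ 'n \<Rightarrow> real)"
    by (rule Ck_imp_continuous[OF Ck_tilted_gaussian[of 0]])
  have "cube_integral (tilted_gaussian t) 0 \<epsilon> k
      = cube_integral (odd_part 0 j (odd_part 0 i (tilted_gaussian t))) 0 \<epsilon> k"
    using cube_integral_odd_part[OF continuous_on_odd_part[OF cont], where k = k and i = j and \<xi> = 0]
      cube_integral_odd_part[OF cont, where k = k and i = i and \<xi> = 0] assms by simp
  then show ?thesis
    unfolding zero by (simp add: cube_integral_def set_lebesgue_integral_def)
qed

lemma tilted_gaussian_0: "tilted_gaussian t (0 :: real ^ 'n::finite) = std_gaussian (0 :: real ^ 'n)"
  by (simp add: tilted_gaussian_def)

lemma partial_tilted_gaussian_0: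
  fixes i :: "'n::finite"
  shows "partial i (tilted_gaussian t) 0 = t * std_gaussian (0 :: real ^ 'n)"
proof -
  \<comment> \<open>The origin is a critical point: the derivative of each factor carries the
    coordinate itself, which is 0 there.\<close>
  have E: "(std_gaussian has_derivative (\<lambda>_. 0)) (at (0 :: real ^ 'n))"
    unfolding std_gaussian_def[abs_def]
    by (rule has_derivative_eq_rhs, rule has_derivative_prod, rule std_normal_density_has_derivative) simp
  have S: "((\<lambda>x :: real ^ 'n. 1 + t * (\<Sum>i\<in>UNIV. sin (x $ i))) has_derivative (\<lambda>v. t * (\<Sum>i\<in>UNIV. v $ i))) (at 0)"
    by (auto intro!: derivative_eq_intros nth_has_derivative)
  have "(tilted_gaussian t has_derivative (\<lambda>v. std_gaussian (0 :: real ^ 'n) * (t * (\<Sum>i\<in>UNIV. v $ i)))) (at (0 :: real ^ 'n))"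
    unfolding tilted_gaussian_def[abs_def]
    by (rule has_derivative_eq_rhs[OF has_derivative_mult[OF E S]]) simp
  from frechet_derivative_at[OF this, symmetric] show ?thesis
    by (simp add: axis_def)
qed

text \<open>The differential moment at the origin as a formal polynomial in the tilt
  \<open>t\<close>, so that coefficients can be compared.\<close>

definition moment_poly :: "'n::finite multiset \<Rightarrow> real poly" where
  "moment_poly B = (if {i. odd (count B i)} = {} then 1
     else if is_singleton {i. odd (count B i)} then [:0, 1:] else 0)"

text \<open>With no or one odd coordinate, \<open>tendsto_local_moment\<close> gives the density or
  a first partial at 0, divided by the density. With two, the local moments already vanish.\<close>

lemma differential_moment_tilted_gaussian:
  fixes B :: "'n::finite multiset"
  assumes t: "0 < t" "t < 1 / CARD('n)"
  shows "differential_moment (density lborel (\<lambda>x. ennreal (tilted_gaussian t x))) (\<lambda>x. x) 0 (count B)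
    = poly (moment_poly B) t"
proof -
  let ?M = "density lborel (\<lambda>x :: real ^ 'n. ennreal (tilted_gaussian t x))"
  note M = prob_space_tilted_gaussian[OF t] distributed_tilted_gaussian[of t] tilted_gaussian_pos[OF t]
  have lim: "differential_moment ?M (\<lambda>x. x) 0 (count B) = L"
    if "((\<lambda>\<epsilon>. local_moment ?M (\<lambda>x. x) 0 \<epsilon> (count B) / normalization \<epsilon> (count B)) \<longlongrightarrow> L) (at_right 0)" for L
    using that unfolding differential_moment_def by (rule tendsto_Lim[OF trivial_limit_at_right_real])
  note smooth = tendsto_local_moment[OF M Ck_tilted_gaussian, THEN lim]
  consider "{i. odd (count B i)} = {}" | i where "{i. odd (count B i)} = {i}"
    | i j where "odd (count B i)" "odd (count B j)" "i \<noteq> j" by blast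
  then show ?thesis
  proof cases
    case 1
    then show ?thesis
      using smooth[of "[]"] std_gaussian_pos[of "0 :: real ^ 'n"]
      by (simp add: moment_poly_def tilted_gaussian_0)
  next
    case 2
    then show ?thesis
      using smooth[of "[i]"] std_gaussian_pos[of "0 :: real ^ 'n"]
      by (simp add: moment_poly_def tilted_gaussian_0 partial_tilted_gaussian_0)
  next
    case 3
    then have "moment_poly B = 0"
      by (auto simp: moment_poly_def is_singleton_def set_eq_iff)
    moreover have "differential_moment ?M (\<lambda>x. x) 0 (count B) = 0"
      by (rule lim) (simp add: local_moment_eq[OF M] cube_integral_tilted_gaussian[of "count B", OF 3])
    ultimately show ?thesis by simp
  qed
qed

section \<open>The non-binary case\<close>

text \<open>Every block has at least one element, and a single larger block makes the inequality
  strict. This singles out the partition into singletons as the one with most blocks.\<close>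

lemma size_partition:
  assumes "{#} \<notin># \<pi>"
  shows "size \<pi> < size (\<Sum>\<^sub># \<pi>) \<or>
    size \<pi> = size (\<Sum>\<^sub># \<pi>) \<and> \<pi> = image_mset (\<lambda>i. {#i#}) (\<Sum>\<^sub># \<pi>)"
  using assms
proof (induction \<pi>)
  case (add B \<pi>)
  then have "0 < size B" by (auto simp: nonempty_has_size)
  then consider "size B = 1" | "1 < size B" by linarith
  then show ?case
  proof cases
    case 1
    then obtain i where "B = {#i#}" by (metis size_1_singleton_mset)
    then show ?thesis using add by auto
  next
    case 2
    then show ?thesis using add by auto
  qed
qed simp

lemma degree_prod_mset_le:
  assumes "\<And>x. degree (f x) \<le> 1"
  shows "degree (\<Prod>x\<in>#A. f x) \<le> size A"
proof (induction A)
  case (add x A)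
  have "degree (f x * (\<Prod>x\<in>#A. f x)) \<le> degree (f x) + degree (\<Prod>x\<in>#A. f x)"
    by (rule degree_mult_le)
  then show ?case
    using add assms[of x] by simp
qed simp

lemma collapse_number_pos: "0 < collapse_number \<pi>"
proof -
  have "0 < vfact v" for v :: "'a \<Rightarrow> nat"
    by (simp add: vfact_def prod_pos)
  moreover from this have "0 < (\<Prod>B\<in>#\<pi>. vfact (count B))"
    by (induction \<pi>) auto
  ultimately show ?thesis
    by (simp add: collapse_number_def prod_pos)
qed

text \<open>A coordinate of multiplicity \<open>a\<close> contributes \<open>2 * a\<close> to the
  exponent of the singletons, but only \<open>a\<close> rounded up to an even number to that of
  \<open>K\<close>. The two differ as soon as \<open>a > 1\<close>, which leaves a positive power of
  0.\<close>

lemma partition_ratio_lim_singletons: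
  fixes K :: "'n::finite multiset"
  assumes "1 < count K i"
  shows "partition_ratio_lim (image_mset (\<lambda>i. {#i#}) K) = 0"
proof -
  have "norm1_plus (count {#i#}) = 2" for i :: 'n
  proof -
    have "norm1_plus (count {#i#}) = (\<Sum>j\<in>UNIV. if j = i then 2 else 0)"
      unfolding norm1_plus_eq_sum by (rule sum.cong) auto
    then show ?thesis by simp
  qed
  then have "(\<Sum>B\<in>#image_mset (\<lambda>i. {#i#}) K. norm1_plus (count B)) = 2 * size K"
    by (simp add: multiset.map_comp comp_def)
  also have "size K = (\<Sum>i\<in>UNIV. count K i)"
    unfolding size_multiset_overloaded_eq by (rule sum.mono_neutral_left) (simp_all add: count_eq_zero_iff)
  finally have sum: "(\<Sum>B\<in>#image_mset (\<lambda>i. {#i#}) K. norm1_plus (count B)) = (\<Sum>i\<in>UNIV. 2 * count K i)"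
    by (simp add: sum_distrib_left)
  have "norm1_plus (count K) < (\<Sum>i\<in>UNIV. 2 * count K i)"
    unfolding norm1_plus_eq_sum
  proof (rule sum_strict_mono_ex1)
    show "\<forall>i\<in>UNIV. count K i + of_bool (odd (count K i)) \<le> 2 * count K i"
    proof
      show "count K i + of_bool (odd (count K i)) \<le> 2 * count K i" for i
        by (cases "count K i") auto
    qed
    show "\<exists>i\<in>UNIV. count K i + of_bool (odd (count K i)) < 2 * count K i"
    proof
      have "a + of_bool (odd a) < 2 * a" if "1 < a" for a :: nat
        using that by simp
      then show "count K i + of_bool (odd (count K i)) < 2 * count K i"
        using assms by blast
    qed simp
  qed simp
  then show ?thesis
    by (simp add: partition_ratio_lim_def sum)
qed

lemma not_cumulant_limit_identity:
  fixes k :: "'n::finite \<Rightarrow> nat"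
  assumes "1 < k i"
  shows "\<not> cumulant_limit_identity TYPE(real ^ 'n) k"
proof
  assume identity: "cumulant_limit_identity TYPE(real ^ 'n) k"
  define C :: "'n multiset multiset \<Rightarrow> real"
    where "C \<pi> = collapse_number \<pi> * (- 1) ^ (size \<pi> - 1) * fact (size \<pi> - 1)" for \<pi>
  \<comment> \<open>At an admissible \<open>t\<close>, the value of \<open>P\<close> is the limit of
    the normalized local cumulant minus the differential cumulant.\<close>
  define P where "P = (\<Sum>\<pi>\<in>multiset_partitions k.
    smult (C \<pi> * (partition_ratio_lim \<pi> - 1)) (\<Prod>B\<in>#\<pi>. moment_poly B))"
  have root: "poly P t = 0" if t: "t \<in> {0<..<1 / CARD('n)}" for t
  proof -
    let ?M = "density lborel (\<lambda>x :: real ^ 'n. ennreal (tilted_gaussian t x))"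
    have t: "0 < t" "t < 1 / CARD('n)" using t by auto
    note M = prob_space_tilted_gaussian[OF t] distributed_tilted_gaussian[of t]
    note moment = differential_moment_tilted_gaussian[OF t]
    have "((\<lambda>\<epsilon>. 1 / normalization \<epsilon> k * local_cumulant ?M (\<lambda>x. x) 0 \<epsilon> k)
        \<longlongrightarrow> differential_cumulant ?M (\<lambda>x. x) 0 k) (at_right 0)"
      using identity M tilted_gaussian_pos[OF t] Ck_tilted_gaussian
      unfolding cumulant_limit_identity_def by blast
    moreover note tendsto_local_cumulant[OF tendsto_differential_moment[OF M tilted_gaussian_pos[OF t]
          Ck_tilted_gaussian], where \<xi> = 0 and k = k]
    ultimately have "differential_cumulant ?M (\<lambda>x. x) 0 k = (\<Sum>\<pi>\<in>multiset_partitions k. C \<pi> *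
        (partition_ratio_lim \<pi> * (\<Prod>B\<in>#\<pi>. poly (moment_poly B) t)))"
      unfolding C_def moment by (rule tendsto_unique[OF trivial_limit_at_right_real])
    moreover have "differential_cumulant ?M (\<lambda>x. x) 0 k
        = (\<Sum>\<pi>\<in>multiset_partitions k. C \<pi> * (\<Prod>B\<in>#\<pi>. poly (moment_poly B) t))"
      by (simp add: differential_cumulant_def cumulant_of_moments_def moment C_def)
    moreover have "poly (\<Prod>B\<in>#\<pi>. moment_poly B) t = (\<Prod>B\<in>#\<pi>. poly (moment_poly B) t)"
      for \<pi> :: "'n multiset multiset"
      by (induction \<pi>) simp_all
    ultimately show ?thesis
      by (simp add: P_def poly_sum left_diff_distrib right_diff_distrib sum_subtractf mult.assoc)
  qed
  have "P = 0"
  proof (rule ccontr)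
    assume "P \<noteq> 0"
    then have "finite {t. poly P t = 0}" by (rule poly_roots_finite)
    then have "finite {0<..<1 / real CARD('n)}"
      by (rule finite_subset[rotated]) (use root in auto)
    then show False by (simp add: infinite_Ioo)
  qed
  obtain K where K: "count K = k"
    using count_Abs_multiset[of k] finite by metis
  define \<pi>0 where "\<pi>0 = image_mset (\<lambda>i. {#i#}) K"
  have sum_\<pi>0: "\<Sum>\<^sub># \<pi>0 = K"
    unfolding \<pi>0_def by (induction K) simp_all
  then have mem: "\<pi>0 \<in> multiset_partitions k"
    by (auto simp: multiset_partitions_def K) (auto simp: \<pi>0_def)
  \<comment> \<open>Every block contributes degree at most 1, so a partition with fewer than
    \<open>size K\<close> blocks cannot reach this coefficient, while singletons contribute exactly
    \<open>t\<close> each.\<close>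
  have coeff: "coeff (\<Prod>B\<in>#\<pi>. moment_poly B) (size K) = (if \<pi> = \<pi>0 then 1 else 0)"
    if "\<pi> \<in> multiset_partitions k" for \<pi>
  proof (cases "\<pi> = \<pi>0")
    case True
    have "(\<Prod>B\<in>#image_mset (\<lambda>i. {#i#}) L. moment_poly B) = monom 1 (size L)" for L :: "'n multiset"
      by (induction L) (auto simp: moment_poly_def monom_Suc is_singleton_def)
    then show ?thesis
      using True by (simp add: \<pi>0_def)
  next
    case False
    have "\<Sum>\<^sub># \<pi> = K" "{#} \<notin># \<pi>"
      using that K by (auto simp: multiset_partitions_def count_inject)
    then have "size \<pi> < size K"
      using False size_partition[of \<pi>] by (auto simp: \<pi>0_def)
    moreover have "degree (\<Prod>B\<in>#\<pi>. moment_poly B) \<le> size \<pi>"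
      by (rule degree_prod_mset_le) (simp add: moment_poly_def)
    ultimately show ?thesis
      using False by (simp add: coeff_eq_0)
  qed
  have "coeff P (size K) = (\<Sum>\<pi>\<in>multiset_partitions k. if \<pi> = \<pi>0 then C \<pi>0 * (partition_ratio_lim \<pi>0 - 1) else 0)"
    unfolding P_def coeff_sum by (rule sum.cong) (simp_all add: coeff)
  \<comment> \<open>Here the non-binary entry enters: the limiting ratio of the singletons is 0,
    leaving the factor -1.\<close>
  also have "\<dots> = - C \<pi>0"
    using mem assms K by (simp add: finite_multiset_partitions \<pi>0_def partition_ratio_lim_singletons[of K i])
  also have "\<dots> \<noteq> 0"
    using collapse_number_pos[of \<pi>0] by (simp add: C_def)
  finally show False
    using \<open>P = 0\<close> by simp
qed

theorem theorem3:
  fixes k :: "'n::finite \<Rightarrow> nat"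
  assumes "k \<noteq> (\<lambda>_. 0)"
  shows "(cumulant_limit_identity TYPE(real ^ 'n) k \<longleftrightarrow> (\<forall>i. k i \<in> {0, 1})) \<and>
         ((\<forall>i. k i \<in> {0, 1}) \<longrightarrow> cumulant_limit_identity TYPE('a) k)"
proof -
  have binary: "(\<forall>i. k i \<in> {0, 1}) \<longleftrightarrow> (\<forall>i. k i \<le> 1)"
    by (auto simp: le_Suc_eq)
  have "cumulant_limit_identity TYPE(real ^ 'n) k \<longleftrightarrow> (\<forall>i. k i \<le> 1)"
    \<comment> \<open>The positive direction holds for any sample type; it is specialized here to
      the type on which the counterexample lives.\<close>
    using cumulant_limit_identity_binary[of k] not_cumulant_limit_identity[of k] by (meson not_le)
  moreover have "(\<forall>i. k i \<le> 1) \<longrightarrow> cumulant_limit_identity TYPE('a) k"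
    using cumulant_limit_identity_binary[of k] by blast
  ultimately show ?thesis
    by (simp only: binary)
qed

end
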